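(* As $m\to\infty$, \[\log\log\log n_m=\log\log z_m+\frac{\psi(z_m)-z_m}{z_m\log z_m}+O\left(\frac{(\psi(z_m)-z_m)^2}{z_m^2\log z_m}\right)+O\left(\frac{\log\log z_m}{z_m}\right).\]
   Context: $\psi(x):=\sum_{p^k\le x}\log p$ is the Chebyshev psi function. Consider all pairs $(q,k)$ with $q$ prime and $k\ge 1$ an integer, with value $z_{q,k}:=q+q^2+\cdots+q^k$. Enumerate these pairs as $(q_1,k_1),(q_2,k_2),\dots$ so that $z_i:=z_{q_i,k_i}$ is nondecreasing in $i$; if $z_{q,k}=z_{p,j}$ with $q>p$, then $(q,k)$ comes before $(p,j)$. For $m\ge1$ let $E_m$ be the set of the first $m$ pairs; for each prime $p$ let $k_p$ be the largest $k$ with $(p,k)\in E_m$ ($k_p=0$ if none), and $n_m:=\prod_p p^{k_p}$. *)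

theory Defs
  imports
    Complex_Main
    "HOL-Library.Infinite_Set"
    "HOL-Library.Landau_Symbols"
    "HOL-Computational_Algebra.Primes"
begin

definition chebyshev_psi :: "real \<Rightarrow> real" where
  "chebyshev_psi x =
     (\<Sum>(p, k) \<in> {(p :: nat, k :: nat). prime p \<and> k \<ge> 1 \<and> real (p ^ k) \<le> x}. ln (real p))"

definition prime_pairs :: "(nat \<times> nat) set" where
  "prime_pairs = {(q, k). prime q \<and> k \<ge> 1}"

definition zval :: "nat \<times> nat \<Rightarrow> nat" where
  "zval = (\<lambda>(q, k). \<Sum>i = 1..k. q ^ i)"

text \<open>
  Enumerations are indexed from 1; the value \<open>e 0\<close> is irrelevant. The order of the pairs is
  determined completely, since two distinct pairs of equal value have distinct primes.
\<close>
definition is_pair_enumeration :: "(nat \<Rightarrow> nat \<times> nat) \<Rightarrow> bool" where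
  "is_pair_enumeration e \<longleftrightarrow>
     bij_betw e {1..} prime_pairs \<and>
     (\<forall>i j. 1 \<le> i \<longrightarrow> i \<le> j \<longrightarrow> zval (e i) \<le> zval (e j)) \<and>
     (\<forall>i j. 1 \<le> i \<longrightarrow> 1 \<le> j \<longrightarrow> zval (e i) = zval (e j) \<longrightarrow> fst (e j) < fst (e i) \<longrightarrow> i < j)"

definition first_pairs :: "(nat \<Rightarrow> nat \<times> nat) \<Rightarrow> nat \<Rightarrow> (nat \<times> nat) set" where
  "first_pairs e m = e ` {1..m}"

definition prime_exponent :: "(nat \<Rightarrow> nat \<times> nat) \<Rightarrow> nat \<Rightarrow> nat \<Rightarrow> nat" where
  "prime_exponent e m p =
     (if \<exists>k. (p, k) \<in> first_pairs e m then Max {k. (p, k) \<in> first_pairs e m} else 0)"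

text \<open>
  The product over all primes is written over the finitely many primes that occur in
  \<open>first_pairs e m\<close>; every other prime has exponent 0.
\<close>
definition n_of :: "(nat \<Rightarrow> nat \<times> nat) \<Rightarrow> nat \<Rightarrow> nat" where
  "n_of e m = (\<Prod>p \<in> fst ` first_pairs e m. p ^ prime_exponent e m p)"

lemma finite_chebyshev_psi_index:
  "finite {(p :: nat, k :: nat). prime p \<and> k \<ge> 1 \<and> real (p ^ k) \<le> x}"
proof (rule finite_subset)
  show "{(p :: nat, k :: nat). prime p \<and> k \<ge> 1 \<and> real (p ^ k) \<le> x}
          \<subseteq> {..nat \<lfloor>x\<rfloor>} \<times> {..nat \<lfloor>x\<rfloor>}"
  proof clarify
    fix p k :: nat
    assume p: "prime p" and k: "k \<ge> 1" and le: "real (p ^ k) \<le> x"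
    have le': "p ^ k \<le> nat \<lfloor>x\<rfloor>"
      using le by (simp add: le_nat_floor)
    have "p \<le> p ^ k"
      using k prime_ge_1_nat[OF p] by (intro self_le_power) auto
    moreover have "k \<le> p ^ k"
      using less_exp[of k] power_mono[OF prime_ge_2_nat[OF p], of k] by linarith
    ultimately show "p \<in> {..nat \<lfloor>x\<rfloor>} \<and> k \<in> {..nat \<lfloor>x\<rfloor>}"
      using le' by simp
  qed
qed simp

lemma zval_ge_fst:
  assumes "x \<in> prime_pairs"
  shows "fst x \<le> zval x"
proof -
  obtain q k where x: "x = (q, k)" by (cases x)
  have "q ^ 1 \<le> (\<Sum>i = 1..k. q ^ i)"
    using assms by (intro member_le_sum) (auto simp: x prime_pairs_def)
  then show ?thesis by (simp add: x zval_def)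
qed

lemma zval_less:
  assumes "prime q" "k < l"
  shows "zval (q, k) < zval (q, l)"
proof -
  have "(\<Sum>i = 1..k. q ^ i) < (\<Sum>i = 1..l. q ^ i)"
    using assms by (intro sum_strict_mono2[where b = l]) (auto simp: prime_gt_0_nat)
  then show ?thesis by (simp add: zval_def)
qed

lemma pair_enumeration_exists: "\<exists>e. is_pair_enumeration e"
proof -
  define c where "c x = zval x * (zval x + 1) + (zval x - fst x)" for x
  have lt: "c x < c y" if "zval x < zval y" for x y
  proof -
    have "c x < (zval x + 1) * (zval x + 1)" by (simp add: c_def)
    also have "\<dots> \<le> zval y * (zval y + 1)"
      using that by (intro mult_mono) auto
    also have "\<dots> \<le> c y" by (simp add: c_def)
    finally show ?thesis .
  qed
  have inj: "inj_on c prime_pairs"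
  proof (rule inj_onI)
    fix x y assume xy: "x \<in> prime_pairs" "y \<in> prime_pairs" and eq: "c x = c y"
    have z: "zval x = zval y" using lt[of x y] lt[of y x] eq by linarith
    then have f: "fst x = fst y"
      using eq zval_ge_fst[OF xy(1)] zval_ge_fst[OF xy(2)] by (simp add: c_def)
    obtain q k l where q: "x = (q, k)" "y = (q, l)"
      using f by (metis prod.collapse)
    have "prime q" using xy by (simp add: q prime_pairs_def)
    then have "k = l"
      using z zval_less[of q k l] zval_less[of q l k] unfolding q by (metis less_irrefl nat_neq_iff)
    then show "x = y" by (simp add: q)
  qed
  have "infinite prime_pairs"
  proof
    assume "finite prime_pairs"
    then have "finite (fst ` prime_pairs)" by simp
    moreover have "fst ` prime_pairs = {p :: nat. prime p}"
      by (force simp: prime_pairs_def)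
    ultimately show False using primes_infinite by simp
  qed
  then have inf: "infinite (c ` prime_pairs)"
    using inj finite_imageD by blast
  define e where "e i = inv_into prime_pairs c (enumerate (c ` prime_pairs) (i - 1))" for i
  have ce: "c (e i) = enumerate (c ` prime_pairs) (i - 1)" for i
    unfolding e_def by (rule f_inv_into_f) (rule enumerate_in_set[OF inf])
  have mono: "c (e i) < c (e j) \<longleftrightarrow> i < j" if "1 \<le> i" "1 \<le> j" for i j
    using that strict_mono_enumerate[OF inf] unfolding ce
    by (auto simp: strict_mono_less)
  have shift: "bij_betw (\<lambda>i :: nat. i - 1) {1..} UNIV"
    by (rule bij_betw_byWitness[where f' = Suc]) auto
  have "bij_betw (inv_into prime_pairs c \<circ> (enumerate (c ` prime_pairs) \<circ> (\<lambda>i. i - 1)))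
          {1..} prime_pairs"
    using bij_betw_trans[OF bij_betw_trans[OF shift bij_enumerate[OF inf]]
        bij_betw_inv_into[OF inj_on_imp_bij_betw[OF inj]]] .
  then have "bij_betw e {1..} prime_pairs"
    by (simp add: e_def[abs_def] o_def)
  moreover have "zval (e i) \<le> zval (e j)" if "1 \<le> i" "i \<le> j" for i j
    using mono[of j i] lt[of "e j" "e i"] that by (meson leD leI order_trans)
  moreover have "i < j"
    if "1 \<le> i" "1 \<le> j" "zval (e i) = zval (e j)" "fst (e j) < fst (e i)" for i j
  proof -
    have "e i \<in> prime_pairs"
      using \<open>bij_betw e {1..} prime_pairs\<close> that(1) by (auto simp: bij_betw_def)
    then have "fst (e i) \<le> zval (e i)" by (rule zval_ge_fst)
    then have "c (e i) < c (e j)"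
      using that by (simp add: c_def)
    then show ?thesis using mono that by simp
  qed
  ultimately have "is_pair_enumeration e"
    unfolding is_pair_enumeration_def by blast
  then show ?thesis by blast
qed

end

theory Submission
  imports Defs "HOL-Analysis.Harmonic_Numbers" "HOL-Real_Asymp.Real_Asymp"
begin

text \<open>
  Since \<open>E\<^sub>m\<close> is closed under lowering the exponent, \<open>ln n\<^sub>m\<close> is the sum of \<open>ln p\<close> over all
  \<open>(p, k) \<in> E\<^sub>m\<close>, a subset of the prime powers up to \<open>z = z\<^sub>m\<close> over which \<open>\<psi>(z)\<close> sums. A missing pair
  has \<open>k \<ge> 2\<close> and \<open>p\<^sup>k \<le> z \<le> p + \<dots> + p\<^sup>k < (p + 1)\<^sup>k\<close>, so there is at most one for each
  \<open>k \<le> log\<^sub>2 z\<close>, and it contributes at most \<open>(ln z) / k\<close>. Hence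
  \<open>0 \<le> \<psi>(z) - ln n\<^sub>m \<le> ln z * ln (log\<^sub>2 z)\<close>. Passing from \<open>ln n\<^sub>m\<close> to \<open>\<psi>(z)\<close> inside \<open>ln ln\<close> costs
  \<open>O(ln ln z / z)\<close>, and expanding \<open>ln ln \<psi>(z)\<close> around \<open>ln ln z\<close> gives the main term and the quadratic
  error. Both steps need that \<open>\<psi>(z) / z\<close> is bounded away from 0, which is Chebyshev's lower bound.
\<close>

section \<open>Prime powers and Chebyshev's lower bound for \<psi>\<close>

definition prime_powers_upto :: "real \<Rightarrow> (nat \<times> nat) set" where
  "prime_powers_upto x = {(p, k). prime p \<and> k \<ge> 1 \<and> real (p ^ k) \<le> x}"

lemma finite_prime_powers_upto: "finite (prime_powers_upto x)"
  unfolding prime_powers_upto_def by (rule finite_chebyshev_psi_index)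

lemma chebyshev_psi_eq: "chebyshev_psi x = (\<Sum>(p, k) \<in> prime_powers_upto x. ln (real p))"
  by (simp add: chebyshev_psi_def prime_powers_upto_def)

lemma chebyshev_psi_mono:
  assumes "x \<le> y"
  shows "chebyshev_psi x \<le> chebyshev_psi y"
  unfolding chebyshev_psi_eq
proof (rule sum_mono2)
  show "prime_powers_upto x \<subseteq> prime_powers_upto y"
    using assms by (auto simp: prime_powers_upto_def)
  show "0 \<le> (case pk of (p, k) \<Rightarrow> ln (real p))"
    if "pk \<in> prime_powers_upto y - prime_powers_upto x" for pk
    using that prime_ge_1_nat by (auto simp: prime_powers_upto_def)
qed (rule finite_prime_powers_upto)

text \<open>This is \<open>ln m = \<Sum>\<Lambda>(d)\<close> over the divisors \<open>d\<close> of
  \<open>m\<close>, with von Mangoldt's \<Lambda>: a prime contributes \<open>ln p\<close> once per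
  exponent up to its multiplicity. The index set depends on \<open>x\<close> instead of
  \<open>m\<close>, so that sums over several \<open>m\<close> can be interchanged.\<close>

lemma ln_nat_eq_sum_prime_powers:
  assumes "0 < m" "real m \<le> x"
  shows "ln (real m) = (\<Sum>(p, k) \<in> prime_powers_upto x. if p ^ k dvd m then ln (real p) else 0)"
proof -
  have pos: "p \<noteq> 0" if "p \<in> prime_factors m" for p
    using that prime_gt_0_nat by (auto simp: in_prime_factors_iff)
  have "real m = (\<Prod>p \<in> prime_factors m. real p ^ multiplicity p m)"
    using prime_factorization_nat[OF assms(1)] by (metis (no_types, lifting) of_nat_power of_nat_prod prod.cong)
  then have "ln (real m) = (\<Sum>p \<in> prime_factors m. ln (real p ^ multiplicity p m))"
    using pos by (simp add: ln_prod)
  also have "\<dots> = (\<Sum>p \<in> prime_factors m. \<Sum>k \<in> {1..multiplicity p m}. ln (real p))"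
    using pos by (intro sum.cong) (auto simp: ln_realpow)
  also have "\<dots> = (\<Sum>(p, k) \<in> Sigma (prime_factors m) (\<lambda>p. {1..multiplicity p m}). ln (real p))"
    by (subst sum.Sigma) auto
  also have "Sigma (prime_factors m) (\<lambda>p. {1..multiplicity p m})
      = {pk \<in> prime_powers_upto x. fst pk ^ snd pk dvd m}"
  proof (intro set_eqI iffI; clarify)
    fix p k assume p: "p \<in> prime_factors m" and k: "k \<in> {1..multiplicity p m}"
    have dvd: "p ^ k dvd m"
      using k by (simp add: multiplicity_dvd')
    then have "real (p ^ k) \<le> real m"
      using assms(1) by (simp only: of_nat_le_iff dvd_imp_le)
    then show "(p, k) \<in> prime_powers_upto x \<and> fst (p, k) ^ snd (p, k) dvd m"
      using dvd p k assms(2) by (auto simp: prime_powers_upto_def in_prime_factors_iff simp del: of_nat_power)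
  next
    fix p k assume pk: "(p, k) \<in> prime_powers_upto x" and dvd: "fst (p, k) ^ snd (p, k) dvd m"
    have p: "prime p" "k \<ge> 1" using pk by (auto simp: prime_powers_upto_def)
    have "p dvd m"
      using dvd p(2) dvd_power[of k p] by (auto intro: dvd_trans)
    moreover have "k \<le> multiplicity p m"
      using dvd p assms(1) by (intro multiplicity_geI) auto
    ultimately show "p \<in> prime_factors m \<and> k \<in> {1..multiplicity p m}"
      using p assms(1) by (auto simp: in_prime_factors_iff)
  qed
  also have "(\<Sum>(p, k) \<in> \<dots>. ln (real p))
      = (\<Sum>(p, k) \<in> prime_powers_upto x. if p ^ k dvd m then ln (real p) else 0)"
    by (subst sum.inter_filter[OF finite_prime_powers_upto]) (auto intro!: sum.cong)
  finally show ?thesis .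
qed

lemma card_multiples_atLeastAtMost:
  fixes d n :: nat
  shows "card {m \<in> {1..n}. d dvd m} = n div d"
proof (induction n)
  case (Suc n)
  have "{m \<in> {1..Suc n}. d dvd m} = {m \<in> {1..n}. d dvd m} \<union> (if d dvd Suc n then {Suc n} else {})"
    by (auto simp: le_Suc_eq)
  then show ?case
    using Suc by (auto simp: div_Suc dvd_eq_mod_eq_0 card_insert_if)
qed auto

text \<open>Legendre's formula in logarithmic form: after swapping the sums, each prime power is
  counted once per multiple of it up to \<open>n\<close>.\<close>

lemma ln_fact_eq_sum_prime_powers:
  assumes "real n \<le> x"
  shows "ln (fact n) = (\<Sum>(p, k) \<in> prime_powers_upto x. real (n div p ^ k) * ln (real p))"
proof -
  have "ln (fact n) = (\<Sum>m = 1..n. ln (real m))"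
    unfolding fact_prod of_nat_prod by (rule ln_prod) auto
  also have "\<dots> = (\<Sum>m = 1..n. \<Sum>(p, k) \<in> prime_powers_upto x. if p ^ k dvd m then ln (real p) else 0)"
    using assms by (intro sum.cong ln_nat_eq_sum_prime_powers) auto
  also have "\<dots> = (\<Sum>(p, k) \<in> prime_powers_upto x. \<Sum>m = 1..n. if p ^ k dvd m then ln (real p) else 0)"
    by (subst sum.swap) (simp add: case_prod_unfold)
  also have "\<dots> = (\<Sum>(p, k) \<in> prime_powers_upto x. real (n div p ^ k) * ln (real p))"
    by (intro sum.cong refl)
      (auto simp flip: sum.inter_filter card_multiples_atLeastAtMost)
  finally show ?thesis .
qed

text \<open>By Legendre's formula each \<open>ln p\<close> enters with coefficient
  \<open>2 * n div p ^ k - 2 * (n div p ^ k)\<close>, which never exceeds 1, while \<psi> counts it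
  with coefficient exactly 1.\<close>

lemma ln_central_binomial_le_chebyshev_psi:
  "ln (real ((2 * n) choose n)) \<le> chebyshev_psi (real (2 * n))"
proof -
  let ?I = "prime_powers_upto (real (2 * n))"
  have "real ((2 * n) choose n) = fact (2 * n) / (fact n * fact n)"
    by (simp add: binomial_fact)
  then have "ln (real ((2 * n) choose n)) = ln (fact (2 * n)) - (ln (fact n) + ln (fact n))"
    by (simp add: ln_div ln_mult)
  also have "\<dots> = (\<Sum>(p, k) \<in> ?I. real (2 * n div p ^ k) * ln (real p)
      - (real (n div p ^ k) * ln (real p) + real (n div p ^ k) * ln (real p)))"
  proof -
    have "ln (fact j) = (\<Sum>(p, k) \<in> ?I. real (j div p ^ k) * ln (real p))" if "j \<le> 2 * n" for j
      using that by (intro ln_fact_eq_sum_prime_powers) (simp only: of_nat_le_iff)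
    from this[of n] this[of "2 * n"] show ?thesis
      by (simp only: case_prod_unfold sum_subtractf sum.distrib)
  qed
  also have "\<dots> \<le> (\<Sum>(p, k) \<in> ?I. ln (real p))"
  proof (rule sum_mono, clarify)
    fix p k assume "(p, k) \<in> ?I"
    then have p: "prime p" by (simp add: prime_powers_upto_def)
    have "2 * n div p ^ k \<le> 2 * (n div p ^ k) + 1"
    proof -
      have "2 * n < (2 * (n div p ^ k) + 2) * p ^ k"
        using dividend_less_div_times[of "p ^ k" n] prime_gt_0_nat[OF p]
        by (simp add: distrib_right)
      then show ?thesis
        using less_mult_imp_div_less[of "2 * n" "2 * (n div p ^ k) + 2" "p ^ k"] by simp
    qed
    then have "real (2 * n div p ^ k) - 2 * real (n div p ^ k) \<le> 1" by linarith
    then have "(real (2 * n div p ^ k) - 2 * real (n div p ^ k)) * ln (real p) \<le> 1 * ln (real p)"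
      using prime_ge_1_nat[OF p] by (intro mult_right_mono) auto
    then show "real (2 * n div p ^ k) * ln (real p)
      - (real (n div p ^ k) * ln (real p) + real (n div p ^ k) * ln (real p)) \<le> ln (real p)"
      by (simp add: algebra_simps)
  qed
  finally show ?thesis by (simp add: chebyshev_psi_eq)
qed

lemma chebyshev_psi_lower_bound:
  assumes "x \<ge> 8"
  shows "chebyshev_psi x \<ge> x / 4"
proof -
  define n where "n = nat \<lfloor>x / 2\<rfloor>"
  have n: "real n \<ge> x / 2 - 1" "real n \<le> x / 2" "n > 0"
    using assms unfolding n_def by linarith+
  \<comment> \<open>This absorbs the denominator of the bound \<open>4 ^ n / (2 * n)\<close> for the
    central binomial coefficient, leaving \<open>2 ^ n\<close>.\<close>
  have "2 * n \<le> 2 ^ n"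
    using n(3) by (induction n rule: nat_induct_non_zero) auto
  then have "2 ^ n * (2 * real n) \<le> 2 ^ n * 2 ^ n"
    by (intro mult_left_mono) (simp_all flip: of_nat_le_iff[where 'a = real])
  also have "\<dots> = (4::real) ^ n" by (simp flip: power_mult_distrib)
  finally have "2 ^ n \<le> 4 ^ n / (2 * real n)"
    using n(3) by (simp add: field_simps)
  also have "\<dots> \<le> real ((2 * n) choose n)"
    using n(3) by (rule central_binomial_lower_bound)
  finally have "ln (2 ^ n) \<le> ln (real ((2 * n) choose n))"
    by (subst ln_le_cancel_iff) (auto intro: less_le_trans[of 0 "2 ^ n"])
  then have "real n * ln 2 \<le> chebyshev_psi (real (2 * n))"
    using ln_central_binomial_le_chebyshev_psi[of n] by (simp add: ln_realpow)
  also have "\<dots> \<le> chebyshev_psi x"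
    using n(2) by (intro chebyshev_psi_mono) simp
  finally have "real n * ln 2 \<le> chebyshev_psi x" .
  \<comment> \<open>The left side is at least \<open>x / 4\<close> exactly when
    \<open>x \<ge> 8\<close>.\<close>
  moreover have "(x / 2 - 1) * (2 / 3) \<le> real n * ln 2"
    using n assms ln2_ge_two_thirds by (intro mult_mono) auto
  ultimately show ?thesis using assms by (simp add: field_simps)
qed

section \<open>Elementary estimates for the missing prime powers\<close>

text \<open>Telescoping with \<open>1 / (K + 1) \<le> ln (K + 1) - ln K\<close>. Starting at 2, the
  least exponent of a missing pair, avoids an additive constant.\<close>

lemma sum_inverse_le_ln:
  assumes "K \<ge> 1"
  shows "(\<Sum>k = 2..K. 1 / real k) \<le> ln (real K)"
  using assms
proof (induction K rule: nat_induct_at_least)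
  case (Suc K)
  have "ln (real K / real (Suc K)) \<le> real K / real (Suc K) - 1"
    using Suc.hyps by (intro ln_le_minus_one) auto
  then have "1 / real (Suc K) \<le> ln (real (Suc K)) - ln (real K)"
    using Suc.hyps by (simp add: ln_div field_simps)
  then show ?case using Suc by simp
qed simp

text \<open>Makes the missing pair unique for each exponent: a larger prime \<open>p'\<close> has
  \<open>p' ^ k \<ge> (p + 1) ^ k\<close>, which already exceeds \<open>zval (p, k)\<close>.\<close>

lemma zval_less_power: "zval (p, k) < (p + 1) ^ k"
proof (induction k)
  case (Suc k)
  have "p ^ Suc k \<le> p * (p + 1) ^ k" unfolding power_Suc by (intro mult_left_mono power_mono) auto
  moreover have "zval (p, Suc k) = zval (p, k) + p ^ Suc k" by (simp add: zval_def)
  moreover have "(p + 1) ^ Suc k = p * (p + 1) ^ k + (p + 1) ^ k" by simp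
  ultimately show ?case using Suc by linarith
qed (simp add: zval_def)

lemma power_le_zval: "k \<ge> 1 \<Longrightarrow> p ^ k \<le> zval (p, k)"
  unfolding zval_def by (auto intro: member_le_sum)

lemma prime_powers_upto_exponent_le:
  assumes "(p, k) \<in> prime_powers_upto x"
  shows "k \<le> nat \<lfloor>log 2 x\<rfloor>"
proof -
  have p: "p \<ge> 2" "real p ^ k \<le> x"
    using assms prime_ge_2_nat by (auto simp: prime_powers_upto_def)
  have "(2::real) ^ k \<le> real p ^ k" using p by (intro power_mono) auto
  then have "2 powr real k \<le> x" using p by (simp add: powr_realpow)
  moreover from this have "x > 0" by (rule less_le_trans[rotated]) simp
  ultimately have "real k \<le> log 2 x" by (simp add: le_log_iff)
  then show ?thesis by (simp add: le_nat_floor)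
qed

section \<open>The first \<open>m\<close> pairs, and \<open>ln n_m\<close> compared with
  \<psi>\<close>

context
  fixes e :: "nat \<Rightarrow> nat \<times> nat"
  assumes enum: "is_pair_enumeration e"
begin

lemma enumeration_less:
  assumes "zval (e i) < zval (e j)" "1 \<le> i" "1 \<le> j"
  shows "i < j"
proof (rule ccontr)
  assume "\<not> i < j"
  then have "zval (e j) \<le> zval (e i)"
    using enum assms unfolding is_pair_enumeration_def by (metis not_less)
  then show False using assms by simp
qed

lemma enumeration_in_prime_pairs: "1 \<le> i \<Longrightarrow> e i \<in> prime_pairs"
  using enum unfolding is_pair_enumeration_def bij_betw_def by auto

lemma enumeration_obtain:
  assumes "x \<in> prime_pairs"
  obtains i where "1 \<le> i" "e i = x"
proof -
  have "x \<in> e ` {1..}"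
    using enum assms unfolding is_pair_enumeration_def bij_betw_def by blast
  then show ?thesis using that by auto
qed

text \<open>For a fixed prime, \<open>zval\<close> strictly increases with the exponent, so the
  smaller exponent is enumerated earlier.\<close>

lemma first_pairs_downward_closed:
  assumes "(p, k) \<in> first_pairs e m" "1 \<le> j" "j \<le> k"
  shows "(p, j) \<in> first_pairs e m"
proof (cases "j = k")
  case False
  obtain i where i: "1 \<le> i" "i \<le> m" "e i = (p, k)"
    using assms(1) by (auto simp: first_pairs_def)
  have p: "prime p"
    using enumeration_in_prime_pairs[OF i(1)] i(3) by (simp add: prime_pairs_def)
  obtain l where l: "1 \<le> l" "e l = (p, j)"
    using enumeration_obtain[of "(p, j)"] p assms(2) by (auto simp: prime_pairs_def)
  have "zval (e l) < zval (e i)"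
    using zval_less[OF p, of j k] False assms(3) by (simp add: i l)
  then have "l < i" using enumeration_less i l by blast
  then show ?thesis using i l by (force simp: first_pairs_def)
qed (use assms in simp)

lemma finite_first_pairs: "finite (first_pairs e m)"
  by (simp add: first_pairs_def)

lemma first_pairs_subset: "first_pairs e m \<subseteq> prime_pairs"
  using enumeration_in_prime_pairs by (auto simp: first_pairs_def)

text \<open>Each prime owns an initial segment of exponents, so its largest exponent is also its
  number of pairs. This turns the logarithm of \<open>n_of e m\<close> into a sum over pairs,
  comparable with \<psi>.\<close>

lemma first_pairs_eq_Sigma:
  "first_pairs e m = Sigma (fst ` first_pairs e m) (\<lambda>p. {1..prime_exponent e m p})"
proof -
  have fin: "finite {k. (p, k) \<in> first_pairs e m}" for p
  proof (rule finite_subset)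
    show "{k. (p, k) \<in> first_pairs e m} \<subseteq> snd ` first_pairs e m"
    proof
      fix k assume "k \<in> {k. (p, k) \<in> first_pairs e m}"
      then show "k \<in> snd ` first_pairs e m" using image_eqI[of k snd "(p, k)"] by simp
    qed
  qed (simp add: finite_first_pairs)
  have le: "k \<in> {1..prime_exponent e m p}" if "(p, k) \<in> first_pairs e m" for p k
  proof -
    have "k \<le> prime_exponent e m p"
      using that fin[of p] Max_ge[of "{k. (p, k) \<in> first_pairs e m}" k]
      by (auto simp: prime_exponent_def)
    moreover have "k \<ge> 1"
      using that first_pairs_subset[of m] by (auto simp: prime_pairs_def)
    ultimately show ?thesis by simp
  qed
  have mem: "(p, k) \<in> first_pairs e m"
    if "(p, j) \<in> first_pairs e m" "k \<in> {1..prime_exponent e m p}" for p j k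
  proof -
    have "Max {k. (p, k) \<in> first_pairs e m} \<in> {k. (p, k) \<in> first_pairs e m}"
      using fin that(1) by (intro Max_in) auto
    then have "(p, prime_exponent e m p) \<in> first_pairs e m"
      using that(1) by (auto simp: prime_exponent_def)
    then show ?thesis
      using that(2) by (auto intro: first_pairs_downward_closed)
  qed
  show ?thesis
  proof
    show "first_pairs e m \<subseteq> Sigma (fst ` first_pairs e m) (\<lambda>p. {1..prime_exponent e m p})"
    proof (rule subrelI)
      fix p k assume pk: "(p, k) \<in> first_pairs e m"
      then show "(p, k) \<in> Sigma (fst ` first_pairs e m) (\<lambda>p. {1..prime_exponent e m p})"
        using imageI[OF pk, of fst] le[OF pk] by simp
    qed
    show "Sigma (fst ` first_pairs e m) (\<lambda>p. {1..prime_exponent e m p}) \<subseteq> first_pairs e m"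
    proof clarify
      fix p j k assume "(p, j) \<in> first_pairs e m" "k \<in> {1..prime_exponent e m (fst (p, j))}"
      then show "(fst (p, j), k) \<in> first_pairs e m" using mem[of p j k] by simp
    qed
  qed
qed

lemma ln_n_of: "ln (real (n_of e m)) = (\<Sum>(p, k) \<in> first_pairs e m. ln (real p))"
proof -
  have pos: "p > 0" if "p \<in> fst ` first_pairs e m" for p
    using that first_pairs_subset[of m] by (auto simp: prime_pairs_def prime_gt_0_nat)
  have "ln (real (n_of e m)) = (\<Sum>p \<in> fst ` first_pairs e m. ln (real p ^ prime_exponent e m p))"
    unfolding n_of_def of_nat_prod of_nat_power
    using pos finite_first_pairs by (intro ln_prod) auto
  also have "\<dots> = (\<Sum>p \<in> fst ` first_pairs e m. \<Sum>k \<in> {1..prime_exponent e m p}. ln (real p))"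
    using pos by (intro sum.cong) (auto simp: ln_realpow)
  also have "\<dots> = (\<Sum>(p, k) \<in> Sigma (fst ` first_pairs e m) (\<lambda>p. {1..prime_exponent e m p}). ln (real p))"
    using finite_first_pairs by (subst sum.Sigma) auto
  finally show ?thesis by (simp only: first_pairs_eq_Sigma[symmetric])
qed

lemma first_pairs_subset_prime_powers_upto:
  "first_pairs e m \<subseteq> prime_powers_upto (real (zval (e m)))"
proof
  fix x assume "x \<in> first_pairs e m"
  then obtain i where i: "1 \<le> i" "i \<le> m" "x = e i" by (auto simp: first_pairs_def)
  obtain p k where pk: "x = (p, k)" by (cases x)
  have "zval (p, k) \<le> zval (e m)"
    using enum i pk unfolding is_pair_enumeration_def by metis
  moreover have "prime p" "k \<ge> 1"
    using enumeration_in_prime_pairs[OF i(1)] i pk by (auto simp: prime_pairs_def)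
  ultimately show "x \<in> prime_powers_upto (real (zval (e m)))"
    using power_le_zval[of k p] pk by (simp add: prime_powers_upto_def del: of_nat_power)
qed

text \<open>The tie-breaking rule of the enumeration is what puts a prime \<open>p = zval (e m)\<close> among the
  first \<open>m\<close> pairs, so that only proper prime powers can be missing.\<close>
lemma missing_prime_power:
  assumes m: "m \<ge> 1"
    and pk: "(p, k) \<in> prime_powers_upto (real (zval (e m))) - first_pairs e m"
  shows "k \<ge> 2" "zval (e m) \<le> zval (p, k)"
proof -
  have p: "prime p" "k \<ge> 1" "p ^ k \<le> zval (e m)"
    using pk by (auto simp: prime_powers_upto_def simp del: of_nat_power)
  obtain j where j: "1 \<le> j" "e j = (p, k)"
    using enumeration_obtain[of "(p, k)"] p by (auto simp: prime_pairs_def)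
  have jm: "m < j"
    using pk j by (force simp: first_pairs_def)
  show le: "zval (e m) \<le> zval (p, k)"
    using enum jm m unfolding is_pair_enumeration_def j(2)[symmetric] by simp
  show "k \<ge> 2"
  proof (rule ccontr)
    assume "\<not> k \<ge> 2"
    then have k: "k = 1" using p by simp
    \<comment> \<open>For \<open>k = 1\<close> the bounds
      \<open>p ^ k \<le> zval (e m) \<le> zval (p, k)\<close> collapse to equality.\<close>
    then have eq: "zval (e m) = p" using p le by (simp add: zval_def)
    obtain q l where q: "e m = (q, l)" by (cases "e m")
    have ql: "prime q" "l \<ge> 1"
      using enumeration_in_prime_pairs[OF m] q by (auto simp: prime_pairs_def)
    have "q \<le> p" using zval_ge_fst[OF enumeration_in_prime_pairs[OF m]] eq q by simp
    moreover have "q \<noteq> p"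
    proof
      assume qp: "q = p"
      then have "l = 1"
        using eq q zval_less[OF ql(1), of 1 l] ql(2) by (cases "l = 1") (auto simp: zval_def)
      then have "e m = e j" using q j k qp by simp
      moreover have "inj_on e {1..}"
        using enum by (simp add: is_pair_enumeration_def bij_betw_def)
      ultimately have "m = j" using m j(1) by (auto dest: inj_onD)
      then show False using jm by simp
    qed
    moreover have "zval (e j) = zval (e m)" using eq j k by (simp add: zval_def)
    \<comment> \<open>The values tie and \<open>q < p\<close>, so the tie-breaking rule puts
      \<open>(p, 1)\<close> before \<open>e m\<close>.\<close>
    ultimately have "j < m"
      using enum m j(1) q unfolding is_pair_enumeration_def
      by (metis fst_conv j(2) le_neq_implies_less)
    then show False using jm by simp
  qed
qed

lemma chebyshev_psi_minus_ln_n_of: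
  assumes m: "m \<ge> 1"
  defines "x \<equiv> real (zval (e m))"
  shows "ln (real (n_of e m)) \<le> chebyshev_psi x"
    and "chebyshev_psi x - ln (real (n_of e m)) \<le> ln x * ln (log 2 x)"
proof -
  define D where "D = prime_powers_upto x - first_pairs e m"
  have D: "prime p" "k \<ge> 2" "p ^ k \<le> zval (e m)" "zval (e m) \<le> zval (p, k)" "(p, k) \<in> prime_powers_upto x"
    if "(p, k) \<in> D" for p k
  proof -
    have pk: "(p, k) \<in> prime_powers_upto (real (zval (e m))) - first_pairs e m"
      using that by (simp add: D_def x_def)
    show "k \<ge> 2" "zval (e m) \<le> zval (p, k)" by (rule missing_prime_power[OF m pk])+
    show "prime p" "p ^ k \<le> zval (e m)" "(p, k) \<in> prime_powers_upto x"
      using pk by (simp_all add: prime_powers_upto_def x_def del: of_nat_power)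
  qed
  have diff: "chebyshev_psi x - ln (real (n_of e m)) = (\<Sum>(p, k) \<in> D. ln (real p))"
    unfolding D_def chebyshev_psi_eq ln_n_of x_def
    using first_pairs_subset_prime_powers_upto by (simp add: sum_diff finite_prime_powers_upto)
  have "(\<Sum>(p, k) \<in> D. ln (real p)) \<ge> 0"
    using D(1) prime_ge_1_nat by (intro sum_nonneg) auto
  then show "ln (real (n_of e m)) \<le> chebyshev_psi x" using diff by simp
  obtain q l where q: "e m = (q, l)" "prime q" "l \<ge> 1"
    using enumeration_in_prime_pairs[OF m] by (auto simp: prime_pairs_def)
  have x2: "x \<ge> 2"
    using zval_ge_fst[OF enumeration_in_prime_pairs[OF m]] prime_ge_2_nat[OF q(2)] q(1)
    by (simp add: x_def)
  \<comment> \<open>Otherwise \<open>zval (e m) \<le> zval (p, k) < (p + 1) ^ k \<le> p' ^ k \<le>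
    zval (e m)\<close>.\<close>
  have not_less: "\<not> p < p'" if "(p, k) \<in> D" "(p', k) \<in> D" for p p' k
  proof
    assume "p < p'"
    then have "(p + 1) ^ k \<le> p' ^ k" by (intro power_mono) auto
    then show False
      using zval_less_power[of p k] D(3,4)[OF that(1)] D(3)[OF that(2)] by linarith
  qed
  have inj: "inj_on snd D"
    using not_less by (intro inj_onI) (metis linorder_neqE_nat prod.collapse)
  define K where "K = nat \<lfloor>log 2 x\<rfloor>"
  have log1: "log 2 x \<ge> 1" using x2 by simp
  then have K: "K \<ge> 1" "real K \<le> log 2 x" unfolding K_def by linarith+
  have finD: "finite D" using finite_prime_powers_upto by (simp add: D_def)
  have "(\<Sum>(p, k) \<in> D. ln (real p)) \<le> (\<Sum>pk \<in> D. ln x * (1 / real (snd pk)))"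
  proof (rule sum_mono, clarify)
    fix p k assume pk: "(p, k) \<in> D"
    have "real p ^ k \<le> x" using D(5)[OF pk] by (simp add: prime_powers_upto_def)
    then have "ln (real p ^ k) \<le> ln x"
      using D(1)[OF pk] x2 prime_gt_0_nat by (subst ln_le_cancel_iff) auto
    then show "ln (real p) \<le> ln x * (1 / real (snd (p, k)))"
      using D(1,2)[OF pk] prime_gt_0_nat[of p] by (simp add: ln_realpow field_simps)
  qed
  also have "\<dots> = (\<Sum>k \<in> snd ` D. ln x * (1 / real k))"
    using inj by (simp add: sum.reindex)
  \<comment> \<open>Exponents without a missing pair only add nonnegative terms.\<close>
  also have "\<dots> \<le> (\<Sum>k \<in> {2..K}. ln x * (1 / real k))"
  proof (rule sum_mono2)
    show "snd ` D \<subseteq> {2..K}"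
      using D(2) prime_powers_upto_exponent_le[OF D(5)] by (auto simp: K_def)
  qed (use x2 in auto)
  also have "\<dots> = ln x * (\<Sum>k \<in> {2..K}. 1 / real k)"
    by (rule sum_distrib_left[symmetric])
  also have "\<dots> \<le> ln x * ln (real K)"
    using x2 sum_inverse_le_ln[OF K(1)] by (intro mult_left_mono) auto
  also have "\<dots> \<le> ln x * ln (log 2 x)"
    using x2 K by (intro mult_left_mono) auto
  finally show "chebyshev_psi x - ln (real (n_of e m)) \<le> ln x * ln (log 2 x)"
    using diff by simp
qed

text \<open>Only finitely many prime powers are at most \<open>B\<close>, and \<open>e\<close> is
  injective on the positive indices, so eventually the prime power of \<open>e m\<close> exceeds
  \<open>B\<close>; its \<open>zval\<close> is at least as large.\<close>

lemma zval_enumeration_at_top: "filterlim (\<lambda>m. real (zval (e m))) at_top sequentially"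
  unfolding filterlim_at_top
proof
  fix B :: real
  have "inj_on e {1..}" using enum by (simp add: is_pair_enumeration_def bij_betw_def)
  then have "finite (e -` prime_powers_upto B \<inter> {1..})"
    using finite_prime_powers_upto by (intro finite_vimage_IntI)
  then have "\<forall>\<^sub>F m in sequentially. m \<notin> e -` prime_powers_upto B \<inter> {1..}"
    unfolding cofinite_eq_sequentially[symmetric] eventually_cofinite by (simp only: not_not Collect_mem_eq)
  then show "\<forall>\<^sub>F m in sequentially. B \<le> real (zval (e m))"
    using eventually_ge_at_top[of 1]
  proof eventually_elim
    case (elim m)
    obtain p k where pk: "e m = (p, k)" by (cases "e m")
    have "prime p" "k \<ge> 1" using enumeration_in_prime_pairs[OF elim(2)] pk by (auto simp: prime_pairs_def)
    then have "real (p ^ k) > B" using elim pk by (auto simp: prime_powers_upto_def)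
    moreover have "real (p ^ k) \<le> real (zval (e m))"
      using power_le_zval[OF \<open>k \<ge> 1\<close>, of p] pk by (simp only: of_nat_le_iff)
    ultimately show ?case by linarith
  qed
qed

end

section \<open>Expansion and Lipschitz bounds for \<open>ln ln\<close>\<close>

text \<open>Both bounds follow from \<open>t / (1 + t) \<le> ln (1 + t) \<le> t\<close>; the 8 is
  the largest value of \<open>1 / (1 + t)\<close>. The threshold matches the later hypothesis
  \<open>y \<ge> z / 8\<close> with \<open>y = z * (1 + t)\<close>.\<close>

lemma ln_one_plus_quadratic_bound:
  fixes t :: real
  assumes "t \<ge> - 7 / 8"
  shows "\<bar>ln (1 + t) - t\<bar> \<le> 8 * t\<^sup>2" "\<bar>ln (1 + t)\<bar> \<le> 8 * \<bar>t\<bar>"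
proof -
  have up: "ln (1 + t) \<le> t" using assms ln_le_minus_one[of "1 + t"] by simp
  have lo: "ln (1 + t) \<ge> t / (1 + t)"
    using assms ln_le_minus_one[of "1 / (1 + t)"] by (simp add: ln_div field_simps)
  have "t - t / (1 + t) = t\<^sup>2 / (1 + t)"
    using assms by (simp add: field_simps power2_eq_square)
  also have "\<dots> \<le> t\<^sup>2 / (1 / 8)"
    using assms by (intro divide_left_mono) auto
  finally have "t - t / (1 + t) \<le> 8 * t\<^sup>2" by simp
  moreover have "t\<^sup>2 \<ge> 0" by simp
  ultimately show "\<bar>ln (1 + t) - t\<bar> \<le> 8 * t\<^sup>2" using up lo by linarith
  show "\<bar>ln (1 + t)\<bar> \<le> 8 * \<bar>t\<bar>"
  proof (cases "t \<ge> 0")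
    case True
    then show ?thesis using up by simp
  next
    case False
    have "(- t) / (1 + t) \<le> (- t) / (1 / 8)"
      using assms False by (intro divide_left_mono) auto
    then have "ln (1 + t) \<ge> 8 * t" using lo by simp
    moreover have "ln (1 + t) \<le> 0" using up False by linarith
    ultimately show ?thesis using False by linarith
  qed
qed

lemma ln_8_le_3: "ln 8 \<le> (3 :: real)"
proof -
  have "ln (2 ^ 3 :: real) = 3 * ln 2" by (subst ln_realpow) simp_all
  then show ?thesis using ln_le_minus_one[of "2 :: real"] by simp
qed

text \<open>Two linearizations: \<open>y = z * (1 + t)\<close> gives
  \<open>ln y = ln z * (1 + u)\<close> with \<open>u = ln (1 + t) / ln z\<close>, so
  \<open>ln (1 + u)\<close> is close to \<open>u\<close>, and \<open>u\<close> is close to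
  \<open>t / ln z\<close>, the main term.\<close>

lemma ln_ln_expansion:
  fixes y z :: real
  assumes z: "z > 0" "ln z \<ge> 6" and y: "y \<ge> z / 8"
  shows "\<bar>ln (ln y) - ln (ln z) - (y - z) / (z * ln z)\<bar> \<le> 100 * ((y - z)\<^sup>2 / (z\<^sup>2 * ln z))"
proof -
  define t where "t = (y - z) / z"
  define v where "v = ln (1 + t)"
  define u where "u = v / ln z"
  have t: "t \<ge> - 7 / 8" using z y by (simp add: t_def field_simps)
  have "y = z * (1 + t)" using z by (simp add: t_def field_simps)
  then have lny: "ln y = ln z + v" using z t by (simp add: v_def ln_mult)
  have "ln (1 / 8) \<le> v"
    using t unfolding v_def by (subst ln_le_cancel_iff) auto
  \<comment> \<open>Together with \<open>ln z \<ge> 6\<close> this keeps \<open>u\<close> at or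
    above \<open>- (1 / 2)\<close>, inside the range of the quadratic bound.\<close>
  then have "v \<ge> - 3" using ln_8_le_3 by (simp add: ln_div)
  then have "- (1 / 2) * ln z \<le> v" using z by linarith
  then have "u \<ge> - (1 / 2)"
    unfolding u_def using z by (subst pos_le_divide_eq) linarith+
  then have u: "u \<ge> - 7 / 8" "u > -1" by auto
  have z1: "z > 1" using z ln_gt_zero_iff[of z] by linarith
  then have "ln y = ln z * (1 + u)" using lny z by (simp add: u_def field_simps)
  then have eq: "ln (ln y) - ln (ln z) = ln (1 + u)" using u z1 by (simp add: ln_mult)
  have "\<bar>v\<bar> \<le> \<bar>8 * t\<bar>"
    using ln_one_plus_quadratic_bound(2)[OF t] by (simp add: v_def abs_mult)
  then have "v\<^sup>2 \<le> (8 * t)\<^sup>2" by (simp only: abs_le_square_iff)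
  \<comment> \<open>Trades one of the two factors \<open>ln z\<close> in the denominator of
    \<open>u\<^sup>2\<close> for the constant 6.\<close>
  moreover have "6 * ln z \<le> ln z * ln z" using z by (intro mult_right_mono) linarith+
  ultimately have "v\<^sup>2 / (ln z * ln z) \<le> (8 * t)\<^sup>2 / (6 * ln z)"
    using z1 by (intro frac_le) auto
  then have "u\<^sup>2 \<le> 32 / 3 * (t\<^sup>2 / ln z)"
    by (simp add: u_def power_divide power2_eq_square)
  then have "\<bar>ln (1 + u) - u\<bar> \<le> 256 / 3 * (t\<^sup>2 / ln z)"
    using ln_one_plus_quadratic_bound(1)[OF u(1)] by linarith
  moreover have "\<bar>u - t / ln z\<bar> \<le> 8 * (t\<^sup>2 / ln z)"
    using ln_one_plus_quadratic_bound(1)[OF t] z1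
    by (simp add: u_def v_def divide_right_mono flip: diff_divide_distrib)
  moreover have "0 \<le> t\<^sup>2 / ln z" using z1 by simp
  \<comment> \<open>The two errors add up to the constant \<open>256 / 3 + 8 < 100\<close>.\<close>
  ultimately have "\<bar>ln (1 + u) - t / ln z\<bar> \<le> 100 * (t\<^sup>2 / ln z)" by linarith
  then show ?thesis by (simp add: eq t_def power_divide)
qed

text \<open>The bound \<open>ln b - ln a \<le> (b - a) / a\<close> is applied to the outer and then
  to the inner logarithm; the denominators \<open>ln x \<ge> ln z / 2\<close> and
  \<open>x \<ge> z / 8\<close> yield the factor 16.\<close>

lemma ln_ln_diff_le:
  fixes x y z :: real
  assumes z: "z > 0" "ln z \<ge> 6" and xy: "z / 8 \<le> x" "x \<le> y"
  shows "ln (ln x) \<le> ln (ln y)" "ln (ln y) - ln (ln x) \<le> 16 * ((y - x) / (z * ln z))"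
proof -
  have "ln z - 3 \<le> ln (z / 8)" using z ln_8_le_3 by (simp add: ln_div)
  also have "\<dots> \<le> ln x" using z xy by simp
  finally have lx: "ln x \<ge> ln z / 2" using z by simp
  have x0: "x > 0" using z xy by (auto intro: less_le_trans[of 0 "z / 8"])
  have lxy: "ln x \<le> ln y" using x0 xy by simp
  then show "ln (ln x) \<le> ln (ln y)" using lx z by simp
  have mvt: "ln b - ln a \<le> (b - a) / a" if "0 < a" "a \<le> b" for a b :: real
    using that ln_le_minus_one[of "b / a"] by (simp add: ln_div field_simps)
  have "ln (ln y) - ln (ln x) \<le> (ln y - ln x) / ln x"
    using lx lxy z by (intro mvt) auto
  also have "\<dots> \<le> (ln y - ln x) / (ln z / 2)"
    using lx lxy z by (intro divide_left_mono mult_pos_pos) linarith+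
  also have "\<dots> \<le> ((y - x) / x) / (ln z / 2)"
    using mvt[of x y] x0 xy z by (intro divide_right_mono) linarith+
  also have "\<dots> \<le> ((y - x) / (z / 8)) / (ln z / 2)"
    using x0 xy z by (intro divide_right_mono divide_left_mono mult_pos_pos) linarith+
  finally show "ln (ln y) - ln (ln x) \<le> 16 * ((y - x) / (z * ln z))" by (simp add: field_simps)
qed

section \<open>The asymptotic formula for \<open>ln ln ln n_m\<close>\<close>

theorem theorem8:
  fixes e :: "nat \<Rightarrow> nat \<times> nat" and z :: "nat \<Rightarrow> real"
  assumes enum: "is_pair_enumeration e"
    and z_def: "\<And>m. z m = real (zval (e m))"
  shows "\<exists>R1 R2 :: nat \<Rightarrow> real.
    R1 \<in> O(\<lambda>m. (chebyshev_psi (z m) - z m)\<^sup>2 / ((z m)\<^sup>2 * ln (z m))) \<and>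
    R2 \<in> O(\<lambda>m. ln (ln (z m)) / z m) \<and>
    (\<forall>\<^sub>F m in sequentially.
      ln (ln (ln (real (n_of e m)))) =
        ln (ln (z m)) + (chebyshev_psi (z m) - z m) / (z m * ln (z m)) + R1 m + R2 m)"
proof -
  \<comment> \<open>The remainders are exact differences, so the identity holds by cancellation and
    only their sizes need proof.\<close>
  define R1 where "R1 m = ln (ln (chebyshev_psi (z m))) - ln (ln (z m))
      - (chebyshev_psi (z m) - z m) / (z m * ln (z m))" for m
  define R2 where "R2 m = ln (ln (ln (real (n_of e m)))) - ln (ln (chebyshev_psi (z m)))" for m
  have z_top: "filterlim z at_top sequentially"
    using zval_enumeration_at_top[OF enum] by (simp add: z_def[abs_def])
  \<comment> \<open>The bound \<open>x / 8\<close> on the missing sum leaves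
    \<open>ln n_m \<ge> z / 4 - z / 8 = z / 8\<close>. The factor 2 before \<open>ln (ln x)\<close>
    absorbs the constant from the change of base in \<open>log 2 x\<close>.\<close>
  have "eventually (\<lambda>x :: real. x \<ge> 8 \<and> ln x \<ge> 6 \<and> ln x * ln (log 2 x) \<le> x / 8
      \<and> ln (log 2 x) \<le> 2 * ln (ln x) \<and> ln (ln x) \<ge> 0) at_top"
    by (intro eventually_conj; real_asymp)
  then have ev: "\<forall>\<^sub>F m in sequentially. z m \<ge> 8 \<and> ln (z m) \<ge> 6
      \<and> ln (z m) * ln (log 2 (z m)) \<le> z m / 8
      \<and> ln (log 2 (z m)) \<le> 2 * ln (ln (z m)) \<and> ln (ln (z m)) \<ge> 0"
    using z_top by (rule eventually_compose_filterlim)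
  have "R1 \<in> O(\<lambda>m. (chebyshev_psi (z m) - z m)\<^sup>2 / ((z m)\<^sup>2 * ln (z m)))"
  proof (rule bigoI[where c = 100])
    show "\<forall>\<^sub>F m in sequentially. norm (R1 m)
        \<le> 100 * norm ((chebyshev_psi (z m) - z m)\<^sup>2 / ((z m)\<^sup>2 * ln (z m)))"
      using ev
    proof eventually_elim
      case (elim m)
      have "chebyshev_psi (z m) \<ge> z m / 8"
        using chebyshev_psi_lower_bound[of "z m"] elim by linarith
      then have "\<bar>R1 m\<bar> \<le> 100 * ((chebyshev_psi (z m) - z m)\<^sup>2 / ((z m)\<^sup>2 * ln (z m)))"
        unfolding R1_def using elim by (intro ln_ln_expansion) auto
      then show ?case using elim by simp
    qed
  qed
  moreover have "R2 \<in> O(\<lambda>m. ln (ln (z m)) / z m)"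
  proof (rule bigoI[where c = 32])
    show "\<forall>\<^sub>F m in sequentially. norm (R2 m) \<le> 32 * norm (ln (ln (z m)) / z m)"
      \<comment> \<open>The enumeration starts at index 1, so \<open>m = 0\<close> is
        excluded.\<close>
      using ev eventually_ge_at_top[of 1]
    proof eventually_elim
      case (elim m)
      define x where "x = ln (real (n_of e m))"
      define y where "y = chebyshev_psi (z m)"
      have z: "z m > 0" "ln (z m) \<ge> 6" using elim by auto
      have xy: "x \<le> y" "y - x \<le> ln (z m) * ln (log 2 (z m))"
        using chebyshev_psi_minus_ln_n_of[OF enum elim(2)] by (auto simp: x_def y_def z_def)
      have "y \<ge> z m / 4"
        using chebyshev_psi_lower_bound[of "z m"] elim by (simp add: y_def)
      then have "z m / 8 \<le> x" using xy elim by linarith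
      note diff = ln_ln_diff_le[OF z this xy(1)]
      have "ln (ln y) - ln (ln x) \<le> 16 * ((y - x) / (z m * ln (z m)))" by (rule diff)
      also have "\<dots> \<le> 16 * ((ln (z m) * (2 * ln (ln (z m)))) / (z m * ln (z m)))"
      proof (intro mult_left_mono divide_right_mono)
        have "ln (z m) * ln (log 2 (z m)) \<le> ln (z m) * (2 * ln (ln (z m)))"
          using elim by (intro mult_left_mono) auto
        then show "y - x \<le> ln (z m) * (2 * ln (ln (z m)))" using xy by linarith
      show "0 \<le> z m * ln (z m)" using z by (intro mult_nonneg_nonneg) linarith+
      qed simp
      also have "\<dots> = 32 * (ln (ln (z m)) / z m)" using z by simp
      finally have "\<bar>R2 m\<bar> \<le> 32 * (ln (ln (z m)) / z m)"
        using diff(1) by (simp add: R2_def x_def y_def)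
      then show ?case using elim by simp
    qed
  qed
  moreover have "\<forall>\<^sub>F m in sequentially. ln (ln (ln (real (n_of e m)))) =
      ln (ln (z m)) + (chebyshev_psi (z m) - z m) / (z m * ln (z m)) + R1 m + R2 m"
    by (simp add: R1_def R2_def)
  ultimately show ?thesis by blast
qed

end
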